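(* Every separable infinite-dimensional real Banach space admits an equivalent norm that is Gâteaux smooth and uniformly rotund in every direction (URED), but is not locally uniformly rotund (LUR).
   Context: Let $|\cdot|$ be an equivalent norm on a Banach space $X$, with unit sphere $S=\{x:|x|=1\}$. - $|\cdot|$ is Gâteaux smooth if for every $x\in S$ and every $y\in S$ one has $\lim_{h\to 0}\frac{|x+hy|+|x-hy|-2}{h}=0$. - $|\cdot|$ is uniformly rotund in every direction (URED) if, for every $z\in X\setminus\{0\}$, $|x_n-y_n|\to 0$ whenever $x_n,y_n\in S$ satisfy $|x_n+y_n|\to 2$ and $x_n-y_n\in\operatorname{span}\{z\}$ for all $n$. - A point $x\in S$ is a locally uniformly rotund (LUR) point if $x_n\to x$ in norm whenever $(x_n)\subset X$ satisfies $\lim_n\left(2|x|^2+2|x_n|^2-|x+x_n|^2\right)=0$. The norm is LUR if every point of $S$ is an LUR point. *)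

theory Defs
  imports "HOL-Analysis.Analysis"
begin

(* Renormings are functions p on the type, because the type class norm is fixed;
   norm below is the original norm of the space. *)

definition is_norm :: "('a::real_vector \<Rightarrow> real) \<Rightarrow> bool" where
  "is_norm p \<longleftrightarrow>
     (\<forall>x. 0 \<le> p x) \<and>
     (\<forall>x. p x = 0 \<longleftrightarrow> x = 0) \<and>
     (\<forall>a x. p (a *\<^sub>R x) = \<bar>a\<bar> * p x) \<and>
     (\<forall>x y. p (x + y) \<le> p x + p y)"

definition equivalent_norm :: "('a::real_normed_vector \<Rightarrow> real) \<Rightarrow> bool" where
  "equivalent_norm p \<longleftrightarrow>
     is_norm p \<and> (\<exists>c>0. \<exists>C>0. \<forall>x. c * norm x \<le> p x \<and> p x \<le> C * norm x)"

definition unit_sphere :: "('a \<Rightarrow> real) \<Rightarrow> 'a set" where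
  "unit_sphere p = {x. p x = 1}"

definition gateaux_smooth :: "('a::real_vector \<Rightarrow> real) \<Rightarrow> bool" where
  "gateaux_smooth p \<longleftrightarrow>
     (\<forall>x\<in>unit_sphere p. \<forall>y\<in>unit_sphere p.
        ((\<lambda>h::real. (p (x + h *\<^sub>R y) + p (x - h *\<^sub>R y) - 2) / h) \<longlongrightarrow> 0) (at 0))"

definition URED :: "('a::real_vector \<Rightarrow> real) \<Rightarrow> bool" where
  "URED p \<longleftrightarrow>
     (\<forall>z. z \<noteq> 0 \<longrightarrow>
        (\<forall>x y :: nat \<Rightarrow> 'a.
           (\<forall>n. x n \<in> unit_sphere p \<and> y n \<in> unit_sphere p \<and> x n - y n \<in> span {z}) \<longrightarrow>
           (\<lambda>n. p (x n + y n)) \<longlonglongrightarrow> 2 \<longrightarrow>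
           (\<lambda>n. p (x n - y n)) \<longlonglongrightarrow> 0))"

definition LUR_point :: "('a::real_vector \<Rightarrow> real) \<Rightarrow> 'a \<Rightarrow> bool" where
  "LUR_point p x \<longleftrightarrow>
     x \<in> unit_sphere p \<and>
     (\<forall>xs :: nat \<Rightarrow> 'a.
        (\<lambda>n. 2 * (p x)\<^sup>2 + 2 * (p (xs n))\<^sup>2 - (p (x + xs n))\<^sup>2) \<longlonglongrightarrow> 0 \<longrightarrow>
        (\<lambda>n. p (xs n - x)) \<longlonglongrightarrow> 0)"

definition LUR :: "('a::real_vector \<Rightarrow> real) \<Rightarrow> bool" where
  "LUR p \<longleftrightarrow> (\<forall>x\<in>unit_sphere p. LUR_point p x)"

(* Not expressed through the library's dim, which is 0 for infinite-dimensional spaces. *)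
definition infinite_dimensional :: "'a::real_vector set \<Rightarrow> bool" where
  "infinite_dimensional V \<longleftrightarrow> \<not> (\<exists>B. finite B \<and> V \<subseteq> span B)"

end

(* Given a norm r and a sequence a with dense span, the infimal convolution
   q x = inf over finite sequences u of sqrt (r (x - sum u_i a_i)^2 + sum u_i^2)
   inherits from the Hilbertian term a quadratic bound on second differences in every direction
   sum w_i a_i, hence by density it is Gateaux smooth. Applied to the original norm, this gives
   (as derivatives) a separating sequence of functionals f_i, and adding sum 2^(-i) f_i^2 to the
   square of a norm makes it URED by the parallelogram law. Applied to
   r = max |f| (norm (x - f x x_0)), with a_0 = x_0 and the other a_i in the kernel of f, it gives a
   smooth norm that is constant on x_0 + {y in ker f, norm y <= 1/2}. In infinite dimension this
   flat piece contains x_0 + y_n with norm y_n = 1/2 and f_0, ..., f_(n-1) vanishing at y_n, so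
   adding the Hilbertian term does not restore local uniform rotundity at x_0. *)

theory Submission
  imports Defs
begin

section \<open>Norms as functions, and smoothness through second differences of squares\<close>

lemma is_norm_nonneg: "is_norm p \<Longrightarrow> 0 \<le> p x"
  and is_norm_eq_0: "is_norm p \<Longrightarrow> p x = 0 \<longleftrightarrow> x = 0"
  and is_norm_scale: "is_norm p \<Longrightarrow> p (c *\<^sub>R x) = \<bar>c\<bar> * p x"
  and is_norm_triangle: "is_norm p \<Longrightarrow> p (x + y) \<le> p x + p y"
  by (auto simp: is_norm_def)

lemma is_norm_zero: "is_norm p \<Longrightarrow> p 0 = 0"
  by (simp add: is_norm_eq_0)

lemma is_norm_minus: "is_norm p \<Longrightarrow> p (- x) = p x"
  using is_norm_scale[of p "-1" x] by simp

lemma is_norm_diff_triangle: "is_norm p \<Longrightarrow> p x \<le> p (x - y) + p y"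
  using is_norm_triangle[of p "x - y" y] by simp

lemma is_norm_sum: "is_norm p \<Longrightarrow> p (\<Sum>i\<in>A. g i) \<le> (\<Sum>i\<in>A. p (g i))"
proof (induction A rule: infinite_finite_induct)
  case (insert i A)
  then show ?case
    using is_norm_triangle[of p "g i" "sum g A"] by auto
qed (auto simp: is_norm_zero)

lemma is_normI:
  assumes "\<And>x. 0 \<le> p x" and "\<And>x. p x = 0 \<Longrightarrow> x = 0"
    and "\<And>c x. p (c *\<^sub>R x) = \<bar>c\<bar> * p x" and "\<And>x y. p (x + y) \<le> p x + p y"
  shows "is_norm p"
  using assms(3)[of 0 0] assms unfolding is_norm_def by auto

text \<open>Squares are used because they add up: a bound for squares passes through the infimum
  defining \<open>q\<close> and through the sum of squares defining \<open>rotund\<close>. An upper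
  bound suffices for a norm, since convexity makes the second difference nonnegative, and
  \<open>h > 0\<close> suffices because the expression is even in \<open>h\<close>.\<close>

definition sq_smooth :: "('a::real_vector \<Rightarrow> real) \<Rightarrow> bool" where
  "sq_smooth p \<longleftrightarrow> (\<forall>x y. \<forall>e>0. \<exists>d>0. \<forall>h. 0 < h \<longrightarrow> h < d \<longrightarrow>
     (p (x + h *\<^sub>R y))\<^sup>2 + (p (x - h *\<^sub>R y))\<^sup>2 - 2 * (p x)\<^sup>2 \<le> e * h)"

lemma second_difference_nonneg:
  assumes "is_norm p"
  shows "0 \<le> p (x + v) + p (x - v) - 2 * p x"
proof -
  have "p (2 *\<^sub>R x) \<le> p (x + v) + p (x - v)"
    using is_norm_triangle[OF assms, of "x + v" "x - v"] by (simp add: scaleR_2)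
  then show ?thesis
    using is_norm_scale[OF assms, of 2 x] by simp
qed

text \<open>The tangent inequality s^2 - 1 \<ge> 2 (s - 1), applied at both points, passes from
  squares back to the norm at a unit vector.\<close>

lemma second_difference_le_sq:
  assumes "is_norm p" "p x = 1"
  shows "2 * (p (x + v) + p (x - v) - 2) \<le> (p (x + v))\<^sup>2 + (p (x - v))\<^sup>2 - 2 * (p x)\<^sup>2"
proof -
  have "0 \<le> (p (x + v) - 1)\<^sup>2 + (p (x - v) - 1)\<^sup>2"
    by simp
  then show ?thesis
    using assms by (simp add: power2_eq_square algebra_simps)
qed

lemma sq_smooth_second_difference:
  assumes "is_norm p" "sq_smooth p" "p x = 1" "e > 0"
  shows "\<exists>d>0. \<forall>h. 0 < h \<longrightarrow> h < d \<longrightarrow> p (x + h *\<^sub>R y) + p (x - h *\<^sub>R y) - 2 \<le> e * h"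
proof -
  obtain d where d: "d > 0" "\<And>h. 0 < h \<Longrightarrow> h < d \<Longrightarrow>
     (p (x + h *\<^sub>R y))\<^sup>2 + (p (x - h *\<^sub>R y))\<^sup>2 - 2 * (p x)\<^sup>2 \<le> e * h"
    using assms unfolding sq_smooth_def by meson
  have "p (x + h *\<^sub>R y) + p (x - h *\<^sub>R y) - 2 \<le> e * h" if h: "0 < h" "h < d" for h
  proof -
    have "2 * (p (x + h *\<^sub>R y) + p (x - h *\<^sub>R y) - 2) \<le> e * h"
      using second_difference_le_sq[OF assms(1,3)] d(2)[OF h] by (meson order_trans)
    moreover have "0 < e * h" using h assms by simp
    ultimately show ?thesis by (smt (verit))
  qed
  with d show ?thesis by blast
qed

text \<open>The second difference is nonnegative by convexity and even in \<open>h\<close>, so the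
  upper bound for \<open>h > 0\<close> controls the quotient on both sides of 0.\<close>

lemma sq_smooth_imp_gateaux_smooth:
  assumes "is_norm p" "sq_smooth p"
  shows "gateaux_smooth p"
  unfolding gateaux_smooth_def
proof (intro ballI)
  fix x y assume "x \<in> unit_sphere p"
  then have px: "p x = 1" by (simp add: unit_sphere_def)
  show "((\<lambda>h. (p (x + h *\<^sub>R y) + p (x - h *\<^sub>R y) - 2) / h) \<longlongrightarrow> 0) (at 0)"
  proof (rule tendstoI)
    fix e :: real assume "e > 0"
    then obtain d where d: "d > 0" "\<And>h. 0 < h \<Longrightarrow> h < d \<Longrightarrow>
        p (x + h *\<^sub>R y) + p (x - h *\<^sub>R y) - 2 \<le> e / 2 * h"
      using sq_smooth_second_difference[OF assms px, of "e / 2"] by (meson half_gt_zero)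
    have "dist ((p (x + h *\<^sub>R y) + p (x - h *\<^sub>R y) - 2) / h) 0 < e"
      if "h \<noteq> 0" "\<bar>h\<bar> < d" for h
    proof -
      have nn: "0 \<le> p (x + h *\<^sub>R y) + p (x - h *\<^sub>R y) - 2"
        using second_difference_nonneg[OF assms(1), of x "h *\<^sub>R y"] px by simp
      have "p (x + h *\<^sub>R y) + p (x - h *\<^sub>R y) - 2 \<le> e / 2 * \<bar>h\<bar>"
        using d(2)[of "\<bar>h\<bar>"] that by (cases "h > 0") (auto simp: abs_if)
      also have "\<dots> < e * \<bar>h\<bar>" using that \<open>e > 0\<close> by simp
      finally show ?thesis
        using that nn by (simp add: divide_less_eq abs_divide)
    qed
    then show "\<forall>\<^sub>F h in at 0. dist ((p (x + h *\<^sub>R y) + p (x - h *\<^sub>R y) - 2) / h) 0 < e"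
      unfolding eventually_at using d(1) by (intro exI[of _ d]) auto
  qed
qed

section \<open>Smoothing a norm by infimal convolution with a Hilbertian norm\<close>

text \<open>The decay in \<open>small\<close> makes \<open>comb\<close> a bounded map from finitely
  supported l2 sequences into (\<open>'a\<close>, \<open>r\<close>), which keeps \<open>q\<close>
  equivalent to \<open>r\<close>. Density of its range extends smoothness from the directions
  \<open>comb N w\<close> to all directions.\<close>

locale inf_convolution =
  fixes r :: "'a::real_vector \<Rightarrow> real" and a :: "nat \<Rightarrow> 'a"
  assumes norm_r: "is_norm r"
    and small: "r (a i) \<le> (1/2) ^ i"
    and dense_span: "e > 0 \<Longrightarrow> \<exists>N w. r (y - (\<Sum>i<N. w i *\<^sub>R a i)) < e"
begin

definition comb :: "nat \<Rightarrow> (nat \<Rightarrow> real) \<Rightarrow> 'a" where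
  "comb N u = (\<Sum>i<N. u i *\<^sub>R a i)"

text \<open>A pair \<open>N\<close>, \<open>u\<close> encodes a finitely supported sequence: entries
  from \<open>N\<close> on are ignored, so one sequence has many encodings, related by zero
  padding.\<close>

definition cost :: "'a \<Rightarrow> nat \<Rightarrow> (nat \<Rightarrow> real) \<Rightarrow> real" where
  "cost x N u = sqrt ((r (x - comb N u))\<^sup>2 + (L2_set u {..<N})\<^sup>2)"

text \<open>The square of \<open>q\<close> is the infimal convolution of the square of
  \<open>r\<close> with the squared l2 norm carried over by \<open>comb\<close>.\<close>

definition q :: "'a \<Rightarrow> real" where
  "q x = (INF z. cost x (fst z) (snd z))"

lemma comb_add: "comb N (\<lambda>i. u i + v i) = comb N u + comb N v"
  by (simp add: comb_def scaleR_left_distrib sum.distrib)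

lemma comb_scale: "comb N (\<lambda>i. c * u i) = c *\<^sub>R comb N u"
  by (simp add: comb_def scaleR_sum_right)

lemma comb_pad: "N \<le> K \<Longrightarrow> comb K (\<lambda>i. if i < N then u i else 0) = comb N u"
  unfolding comb_def by (rule sum.mono_neutral_cong_right) auto

lemma cost_pad: "N \<le> K \<Longrightarrow> cost x K (\<lambda>i. if i < N then u i else 0) = cost x N u"
proof -
  assume "N \<le> K"
  then have "L2_set (\<lambda>i. if i < N then u i else 0) {..<K} = L2_set u {..<N}"
    unfolding L2_set_def by (intro arg_cong[of _ _ sqrt] sum.mono_neutral_cong_right) auto
  then show ?thesis using \<open>N \<le> K\<close> by (simp add: cost_def comb_pad)
qed

lemma cost_nonneg: "0 \<le> cost x N u"
  by (simp add: cost_def)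

lemma q_le_cost: "q x \<le> cost x N u"
  unfolding q_def using cINF_lower[of "\<lambda>z. cost x (fst z) (snd z)" UNIV "(N, u)"]
  by (fastforce intro: bdd_belowI[of _ 0] simp: cost_nonneg)

text \<open>Zero padding leaves the cost unchanged, so lower bounds need checking only for lengths
  from \<open>K\<close> on. This makes room for a given direction of length \<open>K\<close>, or for
  the coordinate 0.\<close>

lemma q_greatest:
  assumes "\<And>N u. K \<le> N \<Longrightarrow> b \<le> cost x N u"
  shows "b \<le> q x"
  unfolding q_def
proof (rule cINF_greatest)
  fix z :: "nat \<times> (nat \<Rightarrow> real)"
  show "b \<le> cost x (fst z) (snd z)"
    using assms[of "max K (fst z)"] cost_pad[of "fst z" "max K (fst z)"] by (metis max.cobounded1 max.cobounded2)
qed simp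

lemma q_nonneg: "0 \<le> q x"
  by (rule q_greatest) (rule cost_nonneg)

lemma q_le: "q x \<le> r x"
  using q_le_cost[of x 0 "\<lambda>_. 0"] is_norm_nonneg[OF norm_r] by (simp add: cost_def comb_def L2_set_def)

lemma r_comb_le: "r (comb N u) \<le> 2 * L2_set u {..<N}"
proof -
  have "r (comb N u) \<le> (\<Sum>i<N. r (u i *\<^sub>R a i))"
    unfolding comb_def by (rule is_norm_sum[OF norm_r])
  also have "\<dots> \<le> (\<Sum>i<N. L2_set u {..<N} * (1/2) ^ i)"
  proof (rule sum_mono)
    fix i assume "i \<in> {..<N}"
    then have "\<bar>u i\<bar> \<le> L2_set u {..<N}"
      using member_le_L2_set[of "{..<N}" i "\<lambda>i. \<bar>u i\<bar>"] by (simp add: L2_set_def)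
    then show "r (u i *\<^sub>R a i) \<le> L2_set u {..<N} * (1/2) ^ i"
      unfolding is_norm_scale[OF norm_r]
      by (intro mult_mono small) (auto simp: is_norm_nonneg[OF norm_r])
  qed
  also have "\<dots> = L2_set u {..<N} * (\<Sum>i<N. (1/2) ^ i)"
    by (simp add: sum_distrib_left)
  also have "\<dots> \<le> L2_set u {..<N} * 2"
    by (intro mult_left_mono) (auto simp: sum_gp_strict)
  finally show ?thesis by simp
qed

text \<open>Split \<open>x\<close> into the residual, of size at most the cost, and the combination,
  of size at most twice the cost by \<open>r_comb_le\<close>; this gives the factor 3.\<close>

lemma le_q: "r x \<le> 3 * q x"
proof -
  have "r x / 3 \<le> cost x N u" for N u
  proof -
    have "r (x - comb N u) \<le> cost x N u" "L2_set u {..<N} \<le> cost x N u"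
      by (auto simp: cost_def intro: real_sqrt_sum_squares_ge1 real_sqrt_sum_squares_ge2)
    then show ?thesis
      using is_norm_diff_triangle[OF norm_r, of x "comb N u"] r_comb_le[of N u] by linarith
  qed
  then have "r x / 3 \<le> q x" by (rule q_greatest)
  then show ?thesis by simp
qed

lemma cost_add: "cost (x + y) N (\<lambda>i. u i + v i) \<le> cost x N u + cost y N v"
proof -
  have "r (x + y - comb N (\<lambda>i. u i + v i)) \<le> r (x - comb N u) + r (y - comb N v)"
    using is_norm_triangle[OF norm_r, of "x - comb N u" "y - comb N v"]
    by (simp add: comb_add algebra_simps)
  moreover have "L2_set (\<lambda>i. u i + v i) {..<N} \<le> L2_set u {..<N} + L2_set v {..<N}"
    by (rule L2_set_triangle_ineq)
  ultimately have "cost (x + y) N (\<lambda>i. u i + v i)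
      \<le> sqrt ((r (x - comb N u) + r (y - comb N v))\<^sup>2 + (L2_set u {..<N} + L2_set v {..<N})\<^sup>2)"
    unfolding cost_def
    by (intro real_sqrt_le_mono add_mono power_mono) (auto simp: is_norm_nonneg[OF norm_r])
  also have "\<dots> \<le> cost x N u + cost y N v"
    unfolding cost_def by (rule real_sqrt_sum_squares_triangle_ineq)
  finally show ?thesis .
qed

lemma cost_scale: "cost (c *\<^sub>R x) N (\<lambda>i. c * u i) = \<bar>c\<bar> * cost x N u"
proof -
  have "r (c *\<^sub>R x - c *\<^sub>R comb N u) = \<bar>c\<bar> * r (x - comb N u)"
    by (simp flip: scaleR_diff_right add: is_norm_scale[OF norm_r])
  moreover have "(L2_set (\<lambda>i. c * u i) {..<N})\<^sup>2 = c\<^sup>2 * (L2_set u {..<N})\<^sup>2"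
    by (simp add: L2_set_def power_mult_distrib sum_distrib_left sum_nonneg)
  ultimately show ?thesis
    by (simp add: cost_def comb_scale power_mult_distrib flip: distrib_left)
       (simp add: real_sqrt_mult)
qed

lemma q_triangle: "q (x + y) \<le> q x + q y"
proof -
  \<comment> \<open>Both sequences are padded to a common length, where they can be added. The
    infima over the two costs are then taken one after the other.\<close>
  have *: "q (x + y) \<le> cost x N u + cost y M v" for N M u v
  proof -
    let ?K = "max N M"
    let ?u = "\<lambda>i. if i < N then u i else 0"
    let ?v = "\<lambda>i. if i < M then v i else 0"
    have "q (x + y) \<le> cost x ?K ?u + cost y ?K ?v"
      using q_le_cost cost_add by (meson order_trans)
    then show ?thesis by (simp only: cost_pad max.cobounded1 max.cobounded2)
  qed
  have "q (x + y) - cost x N u \<le> q y" for N u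
    using * by (intro q_greatest) (simp add: algebra_simps)
  then have "q (x + y) - q y \<le> q x"
    by (intro q_greatest) (smt (verit))
  then show ?thesis by simp
qed

lemma q_scale: "q (c *\<^sub>R x) = \<bar>c\<bar> * q x"
proof -
  \<comment> \<open>One inequality for all nonzero scalars is enough: with the inverse scalar it
    yields the reverse one.\<close>
  have le: "q (c *\<^sub>R x) \<le> \<bar>c\<bar> * q x" if "c \<noteq> 0" for c x
  proof -
    have "q (c *\<^sub>R x) / \<bar>c\<bar> \<le> q x"
    proof (rule q_greatest)
      fix N u
      show "q (c *\<^sub>R x) / \<bar>c\<bar> \<le> cost x N u"
        using q_le_cost[of "c *\<^sub>R x" N "\<lambda>i. c * u i"] that
        by (simp add: cost_scale divide_le_eq mult.commute)
    qed
    then show ?thesis using that by (simp add: divide_le_eq mult.commute)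
  qed
  show ?thesis
  proof (cases "c = 0")
    case True
    then show ?thesis using q_le[of 0] q_nonneg[of 0] is_norm_zero[OF norm_r] by simp
  next
    case False
    then have "q x \<le> q (c *\<^sub>R x) / \<bar>c\<bar>"
      using le[of "inverse c" "c *\<^sub>R x"] by (simp add: field_simps)
    then show ?thesis using le[OF False, of x] False by (simp add: field_simps)
  qed
qed

lemma is_norm_q: "is_norm q"
proof (rule is_normI)
  fix x assume "q x = 0"
  then show "x = 0"
    using le_q[of x] is_norm_nonneg[OF norm_r, of x] is_norm_eq_0[OF norm_r, of x] by simp
qed (simp_all add: q_nonneg q_scale q_triangle)

text \<open>A move of \<open>x\<close> by a multiple of \<open>comb K w\<close> is absorbed by the
  same move of the coefficients. The residual \<open>x - comb N u\<close> stays fixed, so only the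
  Hilbertian term changes, and the parallelogram law computes its second difference.\<close>

lemma q_second_difference:
  "(q (x + h *\<^sub>R comb K w))\<^sup>2 + (q (x - h *\<^sub>R comb K w))\<^sup>2 - 2 * (q x)\<^sup>2
     \<le> 2 * h\<^sup>2 * (L2_set w {..<K})\<^sup>2" (is "?A + ?B - _ \<le> ?C")
proof -
  have main: "?A + ?B - ?C \<le> 2 * (cost x N u)\<^sup>2" if "K \<le> N" for N u
  proof -
    define v where "v = (\<lambda>i. if i < K then w i else 0)"
    have v: "comb N v = comb K w" "(L2_set v {..<N})\<^sup>2 = (L2_set w {..<K})\<^sup>2"
    proof -
      show "comb N v = comb K w" unfolding v_def using that by (rule comb_pad)
      have "L2_set v {..<N} = L2_set w {..<K}"
        unfolding L2_set_def v_def using that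
        by (intro arg_cong[of _ _ sqrt] sum.mono_neutral_cong_right) auto
      then show "(L2_set v {..<N})\<^sup>2 = (L2_set w {..<K})\<^sup>2" by simp
    qed
    have *: "(q (x + t *\<^sub>R comb K w))\<^sup>2 \<le> (r (x - comb N u))\<^sup>2 + (\<Sum>i<N. (u i + t * v i)\<^sup>2)" for t
    proof -
      have "(q (x + t *\<^sub>R comb K w))\<^sup>2 \<le> (cost (x + t *\<^sub>R comb K w) N (\<lambda>i. u i + t * v i))\<^sup>2"
        by (intro power_mono q_le_cost q_nonneg)
      also have "\<dots> = (r (x - comb N u))\<^sup>2 + (\<Sum>i<N. (u i + t * v i)\<^sup>2)"
        by (simp add: cost_def comb_add comb_scale v L2_set_def sum_nonneg)
      finally show ?thesis .
    qed
    have "?A + ?B \<le> 2 * (r (x - comb N u))\<^sup>2 +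
        (\<Sum>i<N. (u i + h * v i)\<^sup>2 + (u i + (- h) * v i)\<^sup>2)"
      using *[of h] *[of "- h"] by (simp add: sum.distrib)
    also have "(\<Sum>i<N. (u i + h * v i)\<^sup>2 + (u i + (- h) * v i)\<^sup>2)
        = (\<Sum>i<N. 2 * (u i)\<^sup>2 + 2 * h\<^sup>2 * (v i)\<^sup>2)"
      by (intro sum.cong) (auto simp: power2_eq_square algebra_simps)
    also have "\<dots> = 2 * (L2_set u {..<N})\<^sup>2 + 2 * h\<^sup>2 * (L2_set v {..<N})\<^sup>2"
      by (simp add: L2_set_def sum_nonneg sum.distrib sum_distrib_left)
    finally show ?thesis
      by (simp add: cost_def v)
  qed
  have "?A + ?B - ?C \<le> 2 * (q x)\<^sup>2"
  \<comment> \<open>Infima bound \<open>q\<close> rather than its square, so a root is taken first;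
    squaring it back requires a nonnegative argument.\<close>
  proof (cases "?A + ?B - ?C \<le> 0")
    case True
    then show ?thesis by (meson order_trans zero_le_mult_iff zero_le_numeral zero_le_power2)
  next
    case False
    have "sqrt ((?A + ?B - ?C) / 2) \<le> q x"
      using main by (intro q_greatest[of K] real_le_lsqrt cost_nonneg) (simp add: mult.commute)
    then have "(sqrt ((?A + ?B - ?C) / 2))\<^sup>2 \<le> (q x)\<^sup>2"
      using False by (intro power_mono) auto
    then show ?thesis using False by simp
  qed
  then show ?thesis by simp
qed

text \<open>Replacing \<open>y\<close> by a nearby \<open>comb K w\<close> costs an error linear in
  \<open>h\<close> with small coefficient, while the second difference along \<open>comb K w\<close>
  is quadratic in \<open>h\<close>. The approximation is fixed first and the range of
  \<open>h\<close> afterwards; each contributes at most half of \<open>e * h\<close>.\<close>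

lemma sq_smooth_q: "sq_smooth q"
  unfolding sq_smooth_def
proof (intro allI impI)
  fix x y and e :: real assume e: "e > 0"
  \<comment> \<open>For |t| < 1, \<open>2 * M\<close> dominates the factor \<open>2 * q (x + t
    *\<^sub>R comb K w) + \<bar>t\<bar> * \<epsilon>\<close> that arises when the perturbed square
    is expanded.\<close>
  define M where "M = q x + q y + 3"
  have M: "M \<ge> 3" using q_nonneg[of x] q_nonneg[of y] by (simp add: M_def)
  define \<epsilon> where "\<epsilon> = min 1 (e / (8 * M))"
  have \<epsilon>: "\<epsilon> > 0" "\<epsilon> \<le> 1" "4 * \<epsilon> * M \<le> e / 2"
    using e M by (auto simp: \<epsilon>_def min_def field_simps)
  obtain K w where "r (y - comb K w) < \<epsilon>"
    using dense_span[OF \<epsilon>(1), of y] unfolding comb_def by blast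
  then have qv: "q (y - comb K w) < \<epsilon>" using q_le le_less_trans by blast
  define L where "L = (L2_set w {..<K})\<^sup>2"
  have L: "L \<ge> 0" by (simp add: L_def)
  define d where "d = min 1 (e / (4 * (L + 1)))"
  have d: "d > 0" using e L by (simp add: d_def)
  have qc: "q (comb K w) \<le> q y + 1"
    using is_norm_diff_triangle[OF is_norm_q, of "- comb K w" "- y"] qv \<epsilon>
    by (simp add: is_norm_minus[OF is_norm_q] algebra_simps)
  have step: "(q (x + t *\<^sub>R y))\<^sup>2 \<le> (q (x + t *\<^sub>R comb K w))\<^sup>2 + 2 * \<bar>t\<bar> * \<epsilon> * M"
    if t: "\<bar>t\<bar> < 1" for t
  proof -
    have "q (t *\<^sub>R (y - comb K w)) \<le> \<bar>t\<bar> * \<epsilon>"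
      unfolding q_scale using qv by (intro mult_left_mono) auto
    then have 1: "q (x + t *\<^sub>R y) \<le> q (x + t *\<^sub>R comb K w) + \<bar>t\<bar> * \<epsilon>"
      using q_triangle[of "x + t *\<^sub>R comb K w" "t *\<^sub>R (y - comb K w)"]
      by (simp add: algebra_simps)
    have "\<bar>t\<bar> * q (comb K w) \<le> 1 * (q y + 1)"
      using t qc q_nonneg by (intro mult_mono) auto
    then have 2: "q (x + t *\<^sub>R comb K w) \<le> q x + q y + 1"
      using q_triangle[of x "t *\<^sub>R comb K w"] by (simp add: q_scale)
    have 3: "\<bar>t\<bar> * \<epsilon> \<le> 1" using t \<epsilon> by (simp add: mult_le_one)
    have "(q (x + t *\<^sub>R y))\<^sup>2 \<le> (q (x + t *\<^sub>R comb K w) + \<bar>t\<bar> * \<epsilon>)\<^sup>2"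
      using 1 q_nonneg by (rule power_mono)
    also have "\<dots> = (q (x + t *\<^sub>R comb K w))\<^sup>2
        + (\<bar>t\<bar> * \<epsilon>) * (2 * q (x + t *\<^sub>R comb K w) + \<bar>t\<bar> * \<epsilon>)"
      by (simp add: power2_eq_square algebra_simps)
    also have "\<dots> \<le> (q (x + t *\<^sub>R comb K w))\<^sup>2 + (\<bar>t\<bar> * \<epsilon>) * (2 * M)"
      using 2 3 \<epsilon> q_nonneg[of x] q_nonneg[of y] by (intro add_left_mono mult_left_mono) (auto simp: M_def)
    finally show ?thesis by simp
  qed
  show "\<exists>d>0. \<forall>h. 0 < h \<longrightarrow> h < d \<longrightarrow>
     (q (x + h *\<^sub>R y))\<^sup>2 + (q (x - h *\<^sub>R y))\<^sup>2 - 2 * (q x)\<^sup>2 \<le> e * h"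
  proof (intro exI[of _ d] conjI allI impI d)
    fix h assume h: "0 < h" "h < d"
    then have h1: "h < 1" and h2: "h * (4 * (L + 1)) < e"
      using L by (auto simp: d_def pos_less_divide_eq)
    have "(q (x + h *\<^sub>R y))\<^sup>2 + (q (x - h *\<^sub>R y))\<^sup>2 - 2 * (q x)\<^sup>2
      \<le> (q (x + h *\<^sub>R comb K w))\<^sup>2 + (q (x - h *\<^sub>R comb K w))\<^sup>2 - 2 * (q x)\<^sup>2 + h * (4 * \<epsilon> * M)"
      using step[of h] step[of "- h"] h h1 by simp
    also have "\<dots> \<le> 2 * h\<^sup>2 * L + h * (e / 2)"
      using q_second_difference[of x h K w] h \<epsilon>(3)
      by (intro add_mono mult_left_mono) (auto simp: L_def)
    also have "2 * h\<^sup>2 * L \<le> h * (e / 2)"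
    proof -
      have "2 * h * L \<le> e / 2" using h2 h by (simp add: algebra_simps)
      then have "h * (2 * h * L) \<le> h * (e / 2)" using h by (intro mult_left_mono) auto
      then show ?thesis by (simp add: power2_eq_square)
    qed
    finally show "(q (x + h *\<^sub>R y))\<^sup>2 + (q (x - h *\<^sub>R y))\<^sup>2 - 2 * (q x)\<^sup>2 \<le> e * h"
      by simp
  qed
qed

end

section \<open>Functionals as derivatives of a smooth norm\<close>

text \<open>A smooth norm yields norming functionals without the Hahn-Banach theorem: the one-sided
  directional derivative is sublinear by convexity and odd by smoothness.\<close>

lemma sq_smooth_supporting_functional_sphere:
  assumes q: "is_norm q" "sq_smooth q" and x: "q x = 1"
  shows "\<exists>f. linear f \<and> (\<forall>y. \<bar>f y\<bar> \<le> q y) \<and> f x = 1"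
proof -
  define g where "g y h = (q (x + h *\<^sub>R y) - 1) / h" for y h
  \<comment> \<open>By convexity the quotients \<open>g y h\<close> increase with \<open>h\<close>,
    so this infimum is the one-sided derivative at \<open>x\<close> in direction \<open>y\<close>.
    The bound \<open>g_lower\<close> makes the \<open>Inf\<close> meaningful.\<close>
  define d where "d y = Inf (g y ` {0<..})" for y
  have g_lower: "- q y \<le> g y h" if "h > 0" for y h
    using is_norm_diff_triangle[OF q(1), of x "- (h *\<^sub>R y)"] that
    by (simp add: g_def is_norm_minus[OF q(1)] is_norm_scale[OF q(1)] x field_simps)
  have d_le: "d y \<le> g y h" if "h > 0" for y h
    unfolding d_def using that g_lower by (intro cINF_lower bdd_belowI2[of _ "- q y"]) auto
  have d_ge: "b \<le> d y" if "\<And>h. h > 0 \<Longrightarrow> b \<le> g y h" for b y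
    unfolding d_def using that by (intro cINF_greatest) auto
  have g_mono: "g y k \<le> g y h" if "0 < k" "k \<le> h" for y k h
  proof -
    have "x + k *\<^sub>R y = (1 - k / h) *\<^sub>R x + (k / h) *\<^sub>R (x + h *\<^sub>R y)"
      using that by (simp add: algebra_simps)
    then have "q (x + k *\<^sub>R y) \<le> q ((1 - k / h) *\<^sub>R x) + q ((k / h) *\<^sub>R (x + h *\<^sub>R y))"
      using is_norm_triangle[OF q(1)] by metis
    also have "\<dots> = (1 - k / h) + (k / h) * q (x + h *\<^sub>R y)"
      unfolding is_norm_scale[OF q(1)] x using that by simp
    finally have "q (x + k *\<^sub>R y) - 1 \<le> (k / h) * (q (x + h *\<^sub>R y) - 1)"
      by (simp add: algebra_simps)
    then show ?thesis using that by (simp add: g_def field_simps)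
  qed
  have d_add: "d (y + z) \<le> d y + d z" for y z
  proof -
    \<comment> \<open>The point \<open>x + l *\<^sub>R (y + z)\<close> is the midpoint of
      \<open>x + (2 * l) *\<^sub>R y\<close> and \<open>x + (2 * l) *\<^sub>R z\<close>; with 2 l at
      most \<open>h\<close> and \<open>k\<close>, monotonicity of the quotients returns to the given
      steps.\<close>
    have *: "d (y + z) \<le> g y h + g z k" if "h > 0" "k > 0" for h k
    proof -
      define l where "l = min h k / 2"
      have l: "l > 0" "2 * l \<le> h" "2 * l \<le> k" using that by (auto simp: l_def)
      have "2 *\<^sub>R (x + l *\<^sub>R (y + z)) = (x + (2 * l) *\<^sub>R y) + (x + (2 * l) *\<^sub>R z)"
        by (simp add: algebra_simps scaleR_2)
      then have "2 * q (x + l *\<^sub>R (y + z)) \<le> q (x + (2 * l) *\<^sub>R y) + q (x + (2 * l) *\<^sub>R z)"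
        using is_norm_triangle[OF q(1), of "x + (2 * l) *\<^sub>R y" "x + (2 * l) *\<^sub>R z"]
          is_norm_scale[OF q(1), of 2 "x + l *\<^sub>R (y + z)"] by simp
      then have "(2 * q (x + l *\<^sub>R (y + z)) - 2) / (2 * l)
          \<le> (q (x + (2 * l) *\<^sub>R y) - 1 + (q (x + (2 * l) *\<^sub>R z) - 1)) / (2 * l)"
        using l by (intro divide_right_mono) auto
      then have "g (y + z) l \<le> g y (2 * l) + g z (2 * l)"
        unfolding g_def add_divide_distrib using l(1)
          mult_divide_mult_cancel_left[of 2 "q (x + l *\<^sub>R (y + z)) - 1" l]
        by (simp add: right_diff_distrib)
      also have "\<dots> \<le> g y h + g z k"
        using l by (intro add_mono g_mono) auto
      finally show ?thesis using d_le[OF l(1), of "y + z"] by simp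
    qed
    have "d (y + z) - g y h \<le> d z" if "h > 0" for h
      using *[OF that] by (intro d_ge) (simp add: algebra_simps)
    then have "d (y + z) - d z \<le> d y"
      by (intro d_ge) (smt (verit))
    then show ?thesis by simp
  qed
  have d_scale_le: "d (c *\<^sub>R y) \<le> c * d y" if "c > 0" for c y
  proof -
    have "d (c *\<^sub>R y) / c \<le> d y"
    proof (rule d_ge)
      fix h :: real assume "h > 0"
      then show "d (c *\<^sub>R y) / c \<le> g y h"
        using d_le[of "h / c" "c *\<^sub>R y"] that by (simp add: g_def field_simps)
    qed
    then show ?thesis using that by (simp add: field_simps)
  qed
  have d_pos_scale: "d (c *\<^sub>R y) = c * d y" if "c > 0" for c y
    using d_scale_le[OF that, of y] d_scale_le[of "inverse c" "c *\<^sub>R y"] that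
    by (simp add: field_simps)
  have d_0: "d 0 = 0"
    using d_le[of 1 0] d_ge[of 0 0] by (simp add: g_def x)
  have d_minus: "d (- y) = - d y" for y
  proof -
    have "d y + d (- y) \<le> 0 + e" if e: "e > 0" for e
    proof -
      obtain t where t: "t > 0" "\<And>h. 0 < h \<Longrightarrow> h < t \<Longrightarrow> q (x + h *\<^sub>R y) + q (x - h *\<^sub>R y) - 2 \<le> e * h"
        using sq_smooth_second_difference[OF q x e, of y] by blast
      define h where "h = t / 2"
      have h: "h > 0" "h < t" using t(1) by (auto simp: h_def)
      have "d y + d (- y) \<le> g y h + g (- y) h"
        by (intro add_mono d_le h)
      also have "\<dots> = (q (x + h *\<^sub>R y) + q (x - h *\<^sub>R y) - 2) / h"
        by (simp add: g_def diff_divide_distrib add_divide_distrib)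
      also have "\<dots> \<le> e" using t(2)[OF h] h by (simp add: divide_le_eq)
      finally show ?thesis by simp
    qed
    then have "d y + d (- y) \<le> 0" by (rule field_le_epsilon)
    then show ?thesis using d_add[of y "- y"] d_0 by simp
  qed
  have "linear d"
  proof (rule linearI)
    fix y z
    show "d (y + z) = d y + d z"
      using d_add[of y z] d_add[of "- y" "- z"] d_minus[of "y + z"] d_minus by simp
  next
    fix c y
    show "d (c *\<^sub>R y) = c *\<^sub>R d y"
      using d_pos_scale[of c y] d_pos_scale[of "- c" y] d_minus[of "c *\<^sub>R y"] d_0
      by (cases c "0 :: real" rule: linorder_cases) auto
  qed
  moreover have d_le_q: "d y \<le> q y" for y
    using d_le[of 1 y] is_norm_triangle[OF q(1), of x y] by (simp add: g_def x)
  have "\<bar>d y\<bar> \<le> q y" for y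
    using d_le_q[of y] d_le_q[of "- y"] d_minus[of y] is_norm_minus[OF q(1), of y] by simp
  moreover have "d x = 1"
  proof -
    have "g x h = 1" if "h > 0" for h
    proof -
      have "q (x + h *\<^sub>R x) = 1 + h"
        using is_norm_scale[OF q(1), of "1 + h" x] that by (simp add: x scaleR_left_distrib)
      then show ?thesis using that by (simp add: g_def)
    qed
    then show ?thesis using d_le[of 1 x] d_ge[of 1 x] by simp
  qed
  ultimately show ?thesis by blast
qed

lemma sq_smooth_supporting_functional:
  assumes q: "is_norm q" "sq_smooth q"
  shows "\<exists>f. linear f \<and> (\<forall>y. \<bar>f y\<bar> \<le> q y) \<and> f x = q x"
proof (cases "x = 0")
  case True
  then show ?thesis
    using is_norm_nonneg[OF q(1)] is_norm_zero[OF q(1)]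
    by (intro exI[of _ "\<lambda>_. 0"]) (auto simp: linear_iff)
next
  case False
  then have qx: "q x > 0"
    using is_norm_nonneg[OF q(1), of x] is_norm_eq_0[OF q(1), of x] by simp
  then have "q ((1 / q x) *\<^sub>R x) = 1"
    by (simp add: is_norm_scale[OF q(1)])
  then obtain f where f: "linear f" "\<forall>y. \<bar>f y\<bar> \<le> q y" "f ((1 / q x) *\<^sub>R x) = 1"
    using sq_smooth_supporting_functional_sphere[OF q] by blast
  then have "f x = q x"
    using qx by (simp add: linear_cmul field_simps)
  with f show ?thesis by blast
qed

section \<open>Countable separating families of functionals\<close>

lemma separable_dense_sequence:
  assumes "separable_space (euclidean :: 'a::real_normed_vector topology)"
  obtains b :: "nat \<Rightarrow> 'a::real_normed_vector"
    where "\<And>y e. e > 0 \<Longrightarrow> \<exists>i. norm (y - b i) < e"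
proof -
  obtain C :: "'a set" where C: "countable C" "closure C = UNIV"
    using assms by (auto simp: separable_space_def)
  then have "C \<noteq> {}" by auto
  have "\<exists>i. norm (y - from_nat_into C i) < e" if e: "e > 0" for y e
  proof -
    obtain c where c: "c \<in> C" "dist c y < e"
      using C(2) closure_approachable[of y C] e by auto
    then obtain i where "from_nat_into C i = c"
      using from_nat_into_surj[OF C(1)] by blast
    then show ?thesis
      using c by (auto simp: dist_norm norm_minus_commute)
  qed
  then show thesis by (rule that)
qed

lemma is_norm_norm: "is_norm norm"
  by (rule is_normI) (auto simp: norm_triangle_ineq)

lemma ex_separating_functionals:
  fixes b :: "nat \<Rightarrow> 'a::real_normed_vector"
  assumes b: "\<And>y e. e > 0 \<Longrightarrow> \<exists>i. norm (y - b i) < e"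
  obtains f :: "nat \<Rightarrow> 'a \<Rightarrow> real" where "\<And>i. linear (f i)" "\<And>i y. \<bar>f i y\<bar> \<le> norm y"
    "\<And>z. z \<noteq> 0 \<Longrightarrow> \<exists>i. f i z \<noteq> 0"
proof -
  \<comment> \<open>Rescaling does not change the span but forces geometric decay; the 1 in the
    denominator covers the case \<open>b i = 0\<close>.\<close>
  define c where "c i = (1/2) ^ i / (1 + norm (b i))" for i :: nat
  have c: "c i > 0" for i by (simp add: c_def add_pos_nonneg)
  interpret inf_convolution norm "\<lambda>i. c i *\<^sub>R b i"
  proof
    fix i
    have "norm (b i) / (1 + norm (b i)) \<le> 1"
      by (simp add: divide_le_eq add_pos_nonneg)
    then have "(1/2) ^ i * (norm (b i) / (1 + norm (b i))) \<le> (1/2) ^ i * 1"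
      by (intro mult_left_mono) auto
    then show "norm (c i *\<^sub>R b i) \<le> (1/2) ^ i"
      by (simp add: c_def abs_divide)
  next
    fix e :: real and y assume "e > 0"
    then obtain i where i: "norm (y - b i) < e" using b by blast
    have "(\<Sum>j<Suc i. (if j = i then 1 / c i else 0) *\<^sub>R c j *\<^sub>R b j)
        = (\<Sum>j<Suc i. if j = i then b i else 0)"
      using c[of i] by (intro sum.cong) auto
    also have "\<dots> = b i" by simp
    finally have "(\<Sum>j<Suc i. (if j = i then 1 / c i else 0) *\<^sub>R c j *\<^sub>R b j) = b i" .
    then show "\<exists>N w. norm (y - (\<Sum>j<N. w j *\<^sub>R c j *\<^sub>R b j)) < e"
      using i by (intro exI[of _ "Suc i"] exI[of _ "\<lambda>j. if j = i then 1 / c i else 0"]) simp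
  qed (rule is_norm_norm)
  \<comment> \<open>For each point of the dense sequence, take a functional that norms it with
    respect to \<open>q\<close>.\<close>
  have "\<forall>i. \<exists>f. linear f \<and> (\<forall>y. \<bar>f y\<bar> \<le> q y) \<and> f (b i) = q (b i)"
    using sq_smooth_supporting_functional[OF is_norm_q sq_smooth_q] by blast
  then obtain f where f: "\<And>i. linear (f i)" "\<And>i y. \<bar>f i y\<bar> \<le> q y" "\<And>i. f i (b i) = q (b i)"
    by (auto dest!: choice)
  have le: "\<bar>f i y\<bar> \<le> norm y" for i y
    by (rule order_trans[OF f(2) q_le])
  have "\<exists>i. f i z \<noteq> 0" if z: "z \<noteq> 0" for z
  proof -
    \<comment> \<open>The constant 4 fits the factor 3 in \<open>le_q\<close>: \<open>b i\<close>
      has norm above 3/4 of \<open>norm z\<close>, so \<open>f i (b i) = q (b i)\<close> exceeds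
      \<open>norm z / 4\<close>, while the error \<open>f i (z - b i)\<close> stays below
      it.\<close>
    obtain i where i: "norm (z - b i) < norm z / 4"
      using b[of "norm z / 4" z] z by auto
    have "f i z = f i (b i) + f i (z - b i)"
      using linear_add[OF f(1), of i "b i" "z - b i"] by simp
    moreover have "norm z \<le> norm (z - b i) + norm (b i)"
      using norm_triangle_sub[of z "b i"] by simp
    ultimately have "f i z > 0"
      using i le[of i "z - b i"] le_q[of "b i"] f(3)[of i] by linarith
    then show ?thesis by (intro exI[of _ i]) simp
  qed
  with f(1) le show thesis by (rule that)
qed

text \<open>Each functional reduces the dimension by at most one. The induction therefore proves
  more, that the common kernel lies in no finite span; comparing with the span of the empty set then
  gives \<open>z\<close>.\<close>

lemma infinite_dimensional_ex_common_kernel: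
  fixes g :: "nat \<Rightarrow> 'a::real_vector \<Rightarrow> real"
  assumes "infinite_dimensional (UNIV :: 'a set)" "\<And>i. linear (g i)"
  shows "\<exists>z. z \<noteq> 0 \<and> (\<forall>i<n. g i z = 0)"
proof -
  have "\<nexists>B. finite B \<and> {z. \<forall>i<n. g i z = 0} \<subseteq> span B"
  proof (induction n)
    case 0
    then show ?case using assms(1) by (simp add: infinite_dimensional_def)
  next
    case (Suc n)
    show ?case
    proof
      assume "\<exists>B. finite B \<and> {z. \<forall>i<Suc n. g i z = 0} \<subseteq> span B"
      then obtain B where B: "finite B" "{z. \<forall>i<Suc n. g i z = 0} \<subseteq> span B" by blast
      obtain w where w: "\<forall>i<n. g i w = 0" and "w \<notin> span B"
        using Suc B(1) by blast
      then have gw: "g n w \<noteq> 0"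
        using B(2) less_Suc_eq by auto
      have "x \<in> span (insert w B)" if x: "\<forall>i<n. g i x = 0" for x
      proof -
        have "x - (g n x / g n w) *\<^sub>R w \<in> span B"
          using x w gw B(2) by (auto simp: less_Suc_eq linear_diff[OF assms(2)] linear_cmul[OF assms(2)])
        then show ?thesis unfolding span_insert by blast
      qed
      then have "{z. \<forall>i<n. g i z = 0} \<subseteq> span (insert w B)" by blast
      with Suc B(1) show False by blast
    qed
  qed
  from this have "\<not> {z. \<forall>i<n. g i z = 0} \<subseteq> span {}"
    by blast
  then show ?thesis by auto
qed

section \<open>A Hilbertian seminorm from a sequence of functionals\<close>

locale functional_sequence =
  fixes f :: "nat \<Rightarrow> 'a::real_normed_vector \<Rightarrow> real"
  assumes linear: "linear (f i)" and bound: "\<bar>f i y\<bar> \<le> norm y"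
begin

text \<open>This is the squared l2 norm of the sequence with entries 2^(-i/2) \<open>f i x\<close>,
  kept as a square so that the parallelogram law is an identity for \<open>Q\<close>.\<close>

definition Q :: "'a \<Rightarrow> real" where
  "Q x = (\<Sum>i. (1/2) ^ i * (f i x)\<^sup>2)"

lemma sq_bound: "(f i x)\<^sup>2 \<le> (norm x)\<^sup>2"
  using bound[of i x] abs_le_square_iff[of "f i x" "norm x"] by simp

lemma summable_Q: "summable (\<lambda>i. (1/2) ^ i * (f i x)\<^sup>2)"
proof (rule summable_comparison_test')
  show "summable (\<lambda>i. (1/2) ^ i * (norm x)\<^sup>2)"
    by (intro summable_mult2 summable_geometric) simp
qed (simp add: sq_bound mult_left_mono)

lemma Q_nonneg: "0 \<le> Q x"
  unfolding Q_def by (rule suminf_nonneg[OF summable_Q]) simp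

lemma Q_pos: "f i x \<noteq> 0 \<Longrightarrow> 0 < Q x"
  unfolding Q_def by (rule suminf_pos2[OF summable_Q, of _ i]) auto

lemma Q_scale: "Q (c *\<^sub>R x) = c\<^sup>2 * Q x"
  unfolding Q_def suminf_mult[OF summable_Q, symmetric]
  by (simp add: linear_cmul[OF linear] power_mult_distrib mult_ac)

lemma Q_parallelogram: "Q (x + y) + Q (x - y) = 2 * Q x + 2 * Q y"
proof -
  have "Q (x + y) + Q (x - y) = (\<Sum>i. (1/2) ^ i * (f i (x + y))\<^sup>2 + (1/2) ^ i * (f i (x - y))\<^sup>2)"
    unfolding Q_def by (intro suminf_add summable_Q)
  also have "\<dots> = (\<Sum>i. 2 * ((1/2) ^ i * (f i x)\<^sup>2) + 2 * ((1/2) ^ i * (f i y)\<^sup>2))"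
    by (simp add: linear_add[OF linear] linear_diff[OF linear] power2_eq_square algebra_simps)
  also have "\<dots> = 2 * Q x + 2 * Q y"
    unfolding Q_def by (subst suminf_add[symmetric]) (auto intro!: summable_mult summable_Q simp: suminf_mult summable_Q)
  finally show ?thesis .
qed

text \<open>Only the tail of a geometric series is left. The case \<open>n = 0\<close> bounds
  \<open>Q\<close> everywhere; large \<open>n\<close> makes \<open>Q\<close> tiny at vectors that
  need not be small in norm, which is how local uniform rotundity will fail.\<close>

lemma Q_le_tail:
  assumes "\<And>i. i < n \<Longrightarrow> f i x = 0"
  shows "Q x \<le> (1/2) ^ n * (2 * (norm x)\<^sup>2)"
proof -
  have "Q x = (\<Sum>i. (1/2) ^ (i + n) * (f (i + n) x)\<^sup>2)"
    unfolding Q_def using suminf_split_initial_segment[OF summable_Q[of x], of n] assms by simp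
  also have "\<dots> \<le> (\<Sum>i. (1/2) ^ i * ((1/2) ^ n * (norm x)\<^sup>2))"
  proof (rule suminf_le)
    fix i
    show "(1/2) ^ (i + n) * (f (i + n) x)\<^sup>2 \<le> (1/2) ^ i * ((1/2) ^ n * (norm x)\<^sup>2)"
      using sq_bound[of "i + n" x] by (simp add: power_add mult_left_mono)
    show "summable (\<lambda>i. (1/2) ^ (i + n) * (f (i + n) x)\<^sup>2)"
      using summable_ignore_initial_segment[OF summable_Q[of x], of n] .
    show "summable (\<lambda>i. (1/2) ^ i * ((1/2) ^ n * (norm x)\<^sup>2))"
      by (intro summable_mult2 summable_geometric) simp
  qed
  also have "\<dots> = (\<Sum>i. (1/2) ^ i) * ((1/2) ^ n * (norm x)\<^sup>2)"
    by (rule suminf_mult2[symmetric]) (simp add: summable_geometric)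
  also have "(\<Sum>i. (1/2 :: real) ^ i) = 2"
    by (simp add: suminf_geometric)
  finally show ?thesis by simp
qed

text \<open>Minkowski's inequality for the finite truncations passes to the limit.\<close>

lemma sqrt_Q_triangle: "sqrt (Q (x + y)) \<le> sqrt (Q x) + sqrt (Q y)"
proof -
  define L where "L x N = L2_set (\<lambda>i. sqrt ((1/2) ^ i) * f i x) {..<N}" for x N
  have L: "L x \<longlonglongrightarrow> sqrt (Q x)" for x
  proof -
    have "L x = (\<lambda>N. sqrt (\<Sum>i<N. (1/2) ^ i * (f i x)\<^sup>2))"
      by (auto simp: L_def L2_set_def power_mult_distrib)
    then show ?thesis
      using summable_LIMSEQ[OF summable_Q, of x] by (auto intro!: tendsto_real_sqrt simp: Q_def)
  qed
  have "L (x + y) N \<le> L x N + L y N" for N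
    unfolding L_def linear_add[OF linear] distrib_left by (rule L2_set_triangle_ineq)
  then show ?thesis
    by (intro LIMSEQ_le[OF L tendsto_add[OF L L]]) blast
qed

definition rotund :: "('a \<Rightarrow> real) \<Rightarrow> 'a \<Rightarrow> real" where
  "rotund q x = sqrt ((q x)\<^sup>2 + Q x)"

lemma rotund_sq: "(rotund q x)\<^sup>2 = (q x)\<^sup>2 + Q x"
  by (simp add: rotund_def Q_nonneg)

lemma le_rotund: "q x \<le> rotund q x"
  unfolding rotund_def by (rule real_le_rsqrt) (simp add: Q_nonneg)

lemma is_norm_rotund:
  assumes q: "is_norm q"
  shows "is_norm (rotund q)"
proof (rule is_normI)
  fix x y :: 'a and c :: real
  show "0 \<le> rotund q x"
    by (simp add: rotund_def Q_nonneg)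
  show "x = 0" if "rotund q x = 0"
    using le_rotund[of q x] is_norm_nonneg[OF q, of x] is_norm_eq_0[OF q, of x] that by simp
  show "rotund q (c *\<^sub>R x) = \<bar>c\<bar> * rotund q x"
    by (simp add: rotund_def is_norm_scale[OF q] Q_scale power_mult_distrib real_sqrt_mult
        flip: distrib_left)
  have "rotund q (x + y) \<le> sqrt ((q x + q y)\<^sup>2 + (sqrt (Q x) + sqrt (Q y))\<^sup>2)"
    unfolding rotund_def
  proof (intro real_sqrt_le_mono add_mono power_mono is_norm_triangle[OF q] is_norm_nonneg[OF q])
    have "(sqrt (Q (x + y)))\<^sup>2 \<le> (sqrt (Q x) + sqrt (Q y))\<^sup>2"
      by (intro power_mono sqrt_Q_triangle) (simp add: Q_nonneg)
    then show "Q (x + y) \<le> (sqrt (Q x) + sqrt (Q y))\<^sup>2"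
      by (simp add: Q_nonneg)
  qed
  also have "\<dots> \<le> rotund q x + rotund q y"
    using real_sqrt_sum_squares_triangle_ineq[of "q x" "q y" "sqrt (Q x)" "sqrt (Q y)"]
    by (simp add: rotund_def Q_nonneg)
  finally show "rotund q (x + y) \<le> rotund q x + rotund q y" .
qed

lemma rotund_le:
  assumes "is_norm q" "q x \<le> C * norm x"
  shows "rotund q x \<le> (C + 2) * norm x"
proof -
  \<comment> \<open>The tail estimate gives twice the squared norm; the factor is rounded up to 4 to
    have a rational root.\<close>
  have "Q x \<le> (2 * norm x)\<^sup>2"
    using Q_le_tail[of 0 x] by (simp add: power_mult_distrib) (smt (verit) zero_le_power2)
  then have "sqrt (Q x) \<le> 2 * norm x"
    by (intro real_le_lsqrt) (auto simp: Q_nonneg)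
  moreover have "rotund q x \<le> q x + sqrt (Q x)"
    using sqrt_add_le_add_sqrt[of "(q x)\<^sup>2" "Q x"] is_norm_nonneg[OF assms(1), of x]
    by (simp add: rotund_def Q_nonneg)
  ultimately show ?thesis using assms(2) by (simp add: algebra_simps)
qed

text \<open>By the parallelogram law the second difference of \<open>Q\<close> along
  \<open>h *\<^sub>R y\<close> is exactly \<open>2 * h\<^sup>2 * Q y\<close>, which is negligible
  against \<open>h\<close>.\<close>

lemma sq_smooth_rotund:
  assumes "sq_smooth q"
  shows "sq_smooth (rotund q)"
  unfolding sq_smooth_def
proof (intro allI impI)
  fix x y and e :: real assume e: "e > 0"
  then obtain d where d: "d > 0" "\<And>h. 0 < h \<Longrightarrow> h < d \<Longrightarrow>
      (q (x + h *\<^sub>R y))\<^sup>2 + (q (x - h *\<^sub>R y))\<^sup>2 - 2 * (q x)\<^sup>2 \<le> e / 2 * h"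
    using assms unfolding sq_smooth_def by (meson half_gt_zero)
  define d' where "d' = min d (e / (4 * (Q y + 1)))"
  have "d' > 0" using d(1) e Q_nonneg[of y] by (simp add: d'_def)
  moreover have "(rotund q (x + h *\<^sub>R y))\<^sup>2 + (rotund q (x - h *\<^sub>R y))\<^sup>2 - 2 * (rotund q x)\<^sup>2 \<le> e * h"
    if h: "0 < h" "h < d'" for h
  proof -
    have "h * (4 * (Q y + 1)) < e"
      using h Q_nonneg[of y] by (simp add: d'_def pos_less_divide_eq)
    then have "2 * h * Q y \<le> e / 2" using h by (simp add: algebra_simps)
    then have "h * (2 * h * Q y) \<le> h * (e / 2)" using h by (intro mult_left_mono) auto
    moreover have "Q (x + h *\<^sub>R y) + Q (x - h *\<^sub>R y) = 2 * Q x + 2 * (h\<^sup>2 * Q y)"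
      using Q_parallelogram[of x "h *\<^sub>R y"] by (simp add: Q_scale)
    moreover have "(q (x + h *\<^sub>R y))\<^sup>2 + (q (x - h *\<^sub>R y))\<^sup>2 - 2 * (q x)\<^sup>2 \<le> e / 2 * h"
      using d(2) h by (simp add: d'_def)
    ultimately show ?thesis unfolding rotund_sq by (simp add: power2_eq_square algebra_simps)
  qed
  ultimately show "\<exists>d>0. \<forall>h. 0 < h \<longrightarrow> h < d \<longrightarrow>
     (rotund q (x + h *\<^sub>R y))\<^sup>2 + (rotund q (x - h *\<^sub>R y))\<^sup>2 - 2 * (rotund q x)\<^sup>2 \<le> e * h"
    by blast
qed

text \<open>Convexity of the square of \<open>q\<close> and the parallelogram law for
  \<open>Q\<close> bound \<open>Q (x n - y n)\<close> by
  \<open>4 - (rotund q (x n + y n))\<^sup>2\<close>, which tends to 0. On a single line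
  \<open>Q\<close> controls the norm, because it is positive at \<open>z\<close>.\<close>

lemma URED_rotund:
  assumes q: "is_norm q" and sep: "\<And>z. z \<noteq> 0 \<Longrightarrow> \<exists>i. f i z \<noteq> 0"
  shows "URED (rotund q)"
  unfolding URED_def
proof (intro allI impI)
  fix z :: 'a and x y :: "nat \<Rightarrow> 'a"
  assume z: "z \<noteq> 0"
    and xy: "\<forall>n. x n \<in> unit_sphere (rotund q) \<and> y n \<in> unit_sphere (rotund q) \<and> x n - y n \<in> span {z}"
    and lim: "(\<lambda>n. rotund q (x n + y n)) \<longlonglongrightarrow> 2"
  let ?p = "rotund q"
  have Qz: "Q z > 0" using sep[OF z] Q_pos by blast
  \<comment> \<open>On the line through \<open>z\<close> the square of the norm and \<open>Q\<close>
    are both quadratic in the scalar, so their ratio is this constant.\<close>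
  define C where "C = (?p z)\<^sup>2 / Q z"
  have le: "(?p (x n - y n))\<^sup>2 \<le> C * (4 - (?p (x n + y n))\<^sup>2)" for n
  proof -
    obtain s where s: "x n - y n = s *\<^sub>R z"
      using xy by (auto simp: span_singleton)
    have "q (x n + y n) \<le> q (x n) + q (y n)"
      by (rule is_norm_triangle[OF q])
    then have "(q (x n + y n))\<^sup>2 \<le> (q (x n) + q (y n))\<^sup>2"
      by (intro power_mono is_norm_nonneg q)
    also have "\<dots> \<le> 2 * (q (x n))\<^sup>2 + 2 * (q (y n))\<^sup>2"
      using sum_squares_bound[of "q (x n)" "q (y n)"] by (simp add: power2_sum)
    finally have *: "(q (x n + y n))\<^sup>2 \<le> 2 * (q (x n))\<^sup>2 + 2 * (q (y n))\<^sup>2" .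
    have "(?p (x n))\<^sup>2 = 1" "(?p (y n))\<^sup>2 = 1"
      using xy by (auto simp: unit_sphere_def)
    then have "Q (x n - y n) \<le> 4 - (?p (x n + y n))\<^sup>2"
      using * Q_parallelogram[of "x n" "y n"] unfolding rotund_sq by linarith
    then have "C * Q (x n - y n) \<le> C * (4 - (?p (x n + y n))\<^sup>2)"
      using Qz by (intro mult_left_mono) (auto simp: C_def)
    moreover have "(?p (x n - y n))\<^sup>2 = C * Q (x n - y n)"
      using Qz by (simp add: s C_def Q_scale is_norm_scale[OF is_norm_rotund[OF q]] power_mult_distrib)
    ultimately show ?thesis by simp
  qed
  have "(\<lambda>n. C * (4 - (?p (x n + y n))\<^sup>2)) \<longlonglongrightarrow> C * (4 - 2\<^sup>2)"
    by (intro tendsto_intros lim)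
  then have lim0: "(\<lambda>n. C * (4 - (?p (x n + y n))\<^sup>2)) \<longlonglongrightarrow> 0"
    by simp
  have "(\<lambda>n. (?p (x n - y n))\<^sup>2) \<longlonglongrightarrow> 0"
    by (rule tendsto_sandwich[OF _ _ tendsto_const lim0]) (intro always_eventually allI zero_le_power2 le)+
  then show "(\<lambda>n. ?p (x n - y n)) \<longlonglongrightarrow> 0"
    by (subst (asm) power_tendsto_0_iff) simp_all
qed

end

section \<open>A smooth norm whose sphere contains a relatively open piece of a hyperplane\<close>

text \<open>Near \<open>x0\<close> on the hyperplane \<open>f = 1\<close>, the value of
  \<open>q\<close> depends on the \<open>x0\<close> component alone: choosing the coefficient t of
  \<open>x0\<close> costs at least (1 - t)^2 + t^2, with minimum 1/2 at t = 1/2. There the residual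
  has \<open>f\<close> value 1/2, which dominates the maximum in \<open>r\<close> as long as
  \<open>norm y\<close> is at most 1/2.\<close>

lemma ex_sq_smooth_flat_norm:
  fixes b :: "nat \<Rightarrow> 'a::real_normed_vector" and f :: "'a \<Rightarrow> real"
  assumes b: "\<And>y e. e > 0 \<Longrightarrow> \<exists>i. norm (y - b i) < e"
    and f: "linear f" "\<And>y. \<bar>f y\<bar> \<le> norm y" "f x0 = 1"
  shows "\<exists>q. equivalent_norm q \<and> sq_smooth q \<and>
    (\<forall>y. f y = 0 \<longrightarrow> norm y \<le> 1/2 \<longrightarrow> q (x0 + y) = sqrt (1/2))"
proof -
  \<comment> \<open>This is the projection onto the kernel of \<open>f\<close> along
    \<open>x0\<close>.\<close>
  define P where "P x = x - f x *\<^sub>R x0" for x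
  define r where "r x = max \<bar>f x\<bar> (norm (P x))" for x
  define A where "A = 1 + norm x0"
  have A: "A > 0" by (simp add: A_def add_pos_nonneg)
  have P_add: "P (x + y) = P x + P y" for x y
    by (simp add: P_def linear_add[OF f(1)] algebra_simps)
  have P_scale: "P (c *\<^sub>R x) = c *\<^sub>R P x" for c x
    by (simp add: P_def linear_cmul[OF f(1)] algebra_simps)
  have fP: "f (P x) = 0" for x
    by (simp add: P_def linear_diff[OF f(1)] linear_cmul[OF f(1)] f(3))
  have PP: "P y = y" if "f y = 0" for y
    using that by (simp add: P_def)
  have r_le: "r x \<le> A * norm x" for x
  proof -
    have "norm (P x) \<le> norm x + \<bar>f x\<bar> * norm x0"
      unfolding P_def using norm_triangle_ineq4[of x "f x *\<^sub>R x0"] by simp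
    also have "\<dots> \<le> norm x + norm x * norm x0"
      by (intro add_left_mono mult_right_mono f) auto
    finally have "norm (P x) \<le> A * norm x" by (simp add: A_def algebra_simps)
    moreover have "\<bar>f x\<bar> \<le> A * norm x"
      using f(2)[of x] by (simp add: A_def algebra_simps add_increasing2)
    ultimately show ?thesis by (simp add: r_def)
  qed
  have le_r: "norm x \<le> A * r x" for x
  proof -
    have "norm x \<le> norm (P x) + \<bar>f x\<bar> * norm x0"
      unfolding P_def using norm_triangle_ineq[of "x - f x *\<^sub>R x0" "f x *\<^sub>R x0"] by simp
    also have "\<dots> \<le> r x + r x * norm x0"
      by (intro add_mono mult_right_mono) (auto simp: r_def)
    finally show ?thesis by (simp add: A_def algebra_simps)
  qed
  have norm_r: "is_norm r"
  proof (rule is_normI)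
    fix x y c
    show "0 \<le> r x" by (simp add: r_def)
    show "x = 0" if "r x = 0" using le_r[of x] that by simp
    show "r (c *\<^sub>R x) = \<bar>c\<bar> * r x"
      by (simp add: r_def P_scale linear_cmul[OF f(1)] abs_mult max_mult_distrib_left)
    show "r (x + y) \<le> r x + r y"
      using norm_triangle_ineq[of "P x" "P y"] abs_triangle_ineq[of "f x" "f y"]
      unfolding r_def P_add linear_add[OF f(1)] by linarith
  qed
  \<comment> \<open>The exponent is \<open>Suc i\<close> because \<open>x0\<close> takes index 0 and
    the vector built from \<open>b i\<close> moves to index \<open>Suc i\<close>.\<close>
  define c where "c i = (1/2) ^ Suc i / (1 + norm (P (b i)))" for i :: nat
  have c: "c i > 0" for i by (simp add: c_def add_pos_nonneg)
  \<comment> \<open>All vectors but the first lie in the kernel of \<open>f\<close>, so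
    \<open>f\<close> reads off the coefficient \<open>u 0\<close> of a combination.\<close>
  define a where "a = case_nat x0 (\<lambda>j. c j *\<^sub>R P (b j))"
  interpret inf_convolution r a
  proof
    fix i
    show "r (a i) \<le> (1/2) ^ i"
    proof (cases i)
      case 0
      then show ?thesis by (simp add: a_def r_def P_def f(3))
    next
      case (Suc j)
      have "norm (P (b j)) / (1 + norm (P (b j))) \<le> 1"
        by (simp add: divide_le_eq add_pos_nonneg)
      then have "(1/2) ^ i * (norm (P (b j)) / (1 + norm (P (b j)))) \<le> (1/2) ^ i * 1"
        by (intro mult_left_mono) auto
      then have "norm (a i) \<le> (1/2) ^ i"
        using c[of j] by (simp add: Suc a_def c_def)
      moreover have "f (a i) = 0"
        by (simp add: Suc a_def linear_cmul[OF f(1)] fP)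
      ultimately show ?thesis by (simp add: r_def PP)
    qed
  next
    fix e :: real and y assume "e > 0"
    then obtain i where i: "norm (y - b i) < e / A" using b[of "e / A" y] A by auto
    \<comment> \<open>These coefficients reproduce \<open>b i\<close> exactly, through its
      decomposition into \<open>f (b i) *\<^sub>R x0\<close> and \<open>P (b i)\<close>.\<close>
    define w where "w = case_nat (f (b i)) (\<lambda>j. if j = i then 1 / c i else 0)"
    have "(\<Sum>j<Suc i. w (Suc j) *\<^sub>R a (Suc j)) = (\<Sum>j<Suc i. if j = i then P (b i) else 0)"
      using c[of i] by (intro sum.cong) (auto simp: w_def a_def)
    also have "\<dots> = P (b i)" by simp
    finally have "(\<Sum>j<Suc (Suc i). w j *\<^sub>R a j) = f (b i) *\<^sub>R x0 + P (b i)"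
      unfolding sum.lessThan_Suc_shift[of _ "Suc i"] by (simp add: w_def a_def)
    then have "(\<Sum>j<Suc (Suc i). w j *\<^sub>R a j) = b i" by (simp add: P_def)
    moreover have "r (y - b i) < e"
      using r_le[of "y - b i"] i A by (simp add: field_simps)
    ultimately show "\<exists>N w. r (y - (\<Sum>j<N. w j *\<^sub>R a j)) < e"
      by (intro exI[of _ "Suc (Suc i)"] exI[of _ w]) simp
  qed (rule norm_r)
  have "1 / (3 * A) * norm x \<le> q x \<and> q x \<le> A * norm x" for x
  proof
    have "norm x \<le> A * (3 * q x)"
      using A by (intro order_trans[OF le_r mult_left_mono[OF le_q]]) simp
    then show "1 / (3 * A) * norm x \<le> q x"
      using A by (simp add: field_simps)
    show "q x \<le> A * norm x" using q_le[of x] r_le[of x] by simp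
  qed
  moreover have "1 / (3 * A) > 0" using A by simp
  ultimately have "equivalent_norm q"
    unfolding equivalent_norm_def using is_norm_q A by blast
  moreover have "q (x0 + y) = sqrt (1/2)" if y: "f y = 0" "norm y \<le> 1/2" for y
  proof (rule antisym)
    have "cost (x0 + y) 1 (\<lambda>_. 1/2) = sqrt (1/2)"
    proof -
      have "x0 + y - comb 1 (\<lambda>_. 1/2) = (1/2) *\<^sub>R x0 + y"
      proof -
        have "comb 1 (\<lambda>_. 1/2) = (1/2) *\<^sub>R x0"
          by (simp add: comb_def) (simp add: a_def)
        then show ?thesis
          using scaleR_left_diff_distrib[of 1 "1/2" x0] by simp
      qed
      moreover have "r ((1/2) *\<^sub>R x0 + y) = 1/2"
        using y PP[of y] by (simp add: r_def P_add P_scale linear_add[OF f(1)] linear_cmul[OF f(1)] f(3) P_def)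
      ultimately have "r (x0 + y - comb 1 (\<lambda>_. 1/2)) = 1/2" by (simp only:)
      then show ?thesis
        unfolding cost_def by (simp only:) (simp add: L2_set_def power2_eq_square)
    qed
    then show "q (x0 + y) \<le> sqrt (1/2)" using q_le_cost by metis
    show "sqrt (1/2) \<le> q (x0 + y)"
    \<comment> \<open>Length at least 1 ensures that the coordinate \<open>u 0\<close> is counted in
      the cost.\<close>
    proof (rule q_greatest[of 1])
      fix N :: nat and u assume "1 \<le> N"
      then obtain M where N: "N = Suc M" by (cases N) auto
      have "f (comb N u) = u 0"
        unfolding comb_def N sum.lessThan_Suc_shift
        by (simp add: linear_add[OF f(1)] linear_sum[OF f(1)] linear_cmul[OF f(1)] a_def fP f(3))
      then have "\<bar>1 - u 0\<bar> \<le> r (x0 + y - comb N u)"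
        by (simp add: r_def linear_add[OF f(1)] linear_diff[OF f(1)] f(3) y)
      then have 1: "(1 - u 0)\<^sup>2 \<le> (r (x0 + y - comb N u))\<^sup>2"
        by (metis abs_ge_zero power2_abs power_mono)
      have 2: "(u 0)\<^sup>2 \<le> (L2_set u {..<N})\<^sup>2"
        using member_le_sum[of 0 "{..<N}" "\<lambda>i. (u i)\<^sup>2"]
        by (simp add: L2_set_def sum_nonneg N del: sum.lessThan_Suc)
      have "0 \<le> (2 * u 0 - 1)\<^sup>2" by simp
      then have "1/2 \<le> (1 - u 0)\<^sup>2 + (u 0)\<^sup>2"
        by (simp add: power2_eq_square algebra_simps)
      then show "sqrt (1/2) \<le> cost (x0 + y) N u"
        unfolding cost_def using 1 2 by (intro real_sqrt_le_mono) linarith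
    qed
  qed
  ultimately show ?thesis using sq_smooth_q by blast
qed

section \<open>Failure of local uniform rotundity on the flat piece\<close>

text \<open>The points x0, x0 + y_n and their midpoint have the same \<open>q\<close> value, so the
  \<open>q\<close> part of the rotundity defect vanishes and only \<open>Q (y n)\<close> remains. It
  tends to 0 although \<open>norm (y n)\<close> stays 1/2.\<close>

lemma (in functional_sequence) not_LUR_rotund:
  assumes inf: "infinite_dimensional (UNIV :: 'a set)"
    and q: "equivalent_norm q" and g: "linear g" "g x0 = (1::real)"
    and flat: "\<And>y. g y = 0 \<Longrightarrow> norm y \<le> 1/2 \<Longrightarrow> q (x0 + y) = sqrt (1/2)"
  shows "\<not> LUR (rotund q)"
proof
  assume LUR: "LUR (rotund q)"
  let ?p = "rotund q"
  have q_norm: "is_norm q" using q by (simp add: equivalent_norm_def)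
  then have p_norm: "is_norm ?p" by (rule is_norm_rotund)
  obtain c where c: "c > 0" "\<And>x. c * norm x \<le> q x"
    using q by (auto simp: equivalent_norm_def)
  have "\<exists>y. g y = 0 \<and> norm y = 1/2 \<and> (\<forall>i<n. f i y = 0)" for n
  proof -
    \<comment> \<open>Prepending \<open>g\<close> to the sequence lets one choice of
      \<open>z\<close> handle the \<open>n + 1\<close> conditions on \<open>g\<close> and on the
      first \<open>n\<close> functionals.\<close>
    have "linear (case_nat g f i)" for i
      using g(1) linear by (cases i) auto
    then obtain z where z: "z \<noteq> 0" "\<forall>i<Suc n. case_nat g f i z = 0"
      using infinite_dimensional_ex_common_kernel[OF inf] by metis
    define y where "y = (1 / (2 * norm z)) *\<^sub>R z"
    have "g z = 0" using z(2) by auto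
    moreover have "f i z = 0" if "i < n" for i using z(2) that by (auto dest: spec[of _ "Suc i"])
    ultimately show ?thesis using z(1)
      by (intro exI[of _ y]) (auto simp: y_def linear_cmul[OF linear] linear_cmul[OF g(1)])
  qed
  then obtain y where y: "\<And>n. g (y n) = 0" "\<And>n. norm (y n) = 1/2" "\<And>n i. i < n \<Longrightarrow> f i (y n) = 0"
    by metis
  have Qy: "(\<lambda>n. Q (y n)) \<longlonglongrightarrow> 0"
  proof (rule tendsto_sandwich[OF _ _ tendsto_const])
    show "\<forall>\<^sub>F n in sequentially. Q (y n) \<le> (1/2) ^ n * (2 * (1/2)\<^sup>2)"
      using Q_le_tail[OF y(3)] by (simp add: y(2))
    show "(\<lambda>n. (1/2) ^ n * (2 * (1/2)\<^sup>2) :: real) \<longlonglongrightarrow> 0"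
      using tendsto_mult_left_zero[OF LIMSEQ_power_zero[of "1/2 :: real"]] by simp
  qed (simp add: Q_nonneg)
  have "x0 \<noteq> 0" using g linear_0 by force
  \<comment> \<open>Only the base point has to be moved to the unit sphere; the sequence in
    \<open>LUR_point\<close> may leave it, so one common scaling serves for both.\<close>
  define \<mu> where "\<mu> = ?p x0"
  have \<mu>: "\<mu> > 0"
    using is_norm_nonneg[OF p_norm, of x0] is_norm_eq_0[OF p_norm, of x0] \<open>x0 \<noteq> 0\<close> by (simp add: \<mu>_def)
  define x where "x = (1 / \<mu>) *\<^sub>R x0"
  define xs where "xs n = (1 / \<mu>) *\<^sub>R (x0 + y n)" for n
  have scale: "?p ((1 / \<mu>) *\<^sub>R v) = ?p v / \<mu>" for v
    using \<mu> by (simp add: is_norm_scale[OF p_norm])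
  have "x \<in> unit_sphere ?p"
    using \<mu> by (simp add: unit_sphere_def x_def scale) (simp add: \<mu>_def)
  then have LUR_x: "LUR_point ?p x" using LUR by (simp add: LUR_def)
  have "2 * (?p x)\<^sup>2 + 2 * (?p (xs n))\<^sup>2 - (?p (x + xs n))\<^sup>2 = Q (y n) / \<mu>\<^sup>2" for n
  proof -
    have sum: "x + xs n = (1 / \<mu>) *\<^sub>R (x0 + (x0 + y n))"
      by (simp add: x_def xs_def scaleR_right_distrib)
    \<comment> \<open>Half of \<open>y n\<close> still satisfies the conditions of
      \<open>flat\<close>, so the midpoint lies on the flat piece too.\<close>
    have "x0 + (x0 + y n) = 2 *\<^sub>R (x0 + (1/2) *\<^sub>R y n)"
      by (simp add: algebra_simps scaleR_2)
    then have "q (x0 + (x0 + y n)) = 2 * q (x0 + (1/2) *\<^sub>R y n)"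
      using is_norm_scale[OF q_norm] by (metis abs_numeral)
    also have "\<dots> = 2 * sqrt (1/2)"
      by (subst flat) (auto simp: y linear_cmul[OF g(1)])
    finally have "(q (x0 + (x0 + y n)))\<^sup>2 = 2" by (simp add: power_mult_distrib)
    moreover have "(q x0)\<^sup>2 = 1/2" using flat[of 0] linear_0[OF g(1)] by simp
    moreover have "(q (x0 + y n))\<^sup>2 = 1/2" using flat[of "y n"] y by simp
    moreover have "Q (x0 + (x0 + y n)) + Q (y n) = 2 * Q x0 + 2 * Q (x0 + y n)"
      using Q_parallelogram[of "x0 + y n" x0] by (simp add: add.commute)
    ultimately have "2 * (?p x0)\<^sup>2 + 2 * (?p (x0 + y n))\<^sup>2 - (?p (x0 + (x0 + y n)))\<^sup>2 = Q (y n)"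
      unfolding rotund_sq by (smt (verit) field_sum_of_halves)
    then show ?thesis
      unfolding sum unfolding x_def xs_def scale power_divide times_divide_eq_right
      by (simp flip: add_divide_distrib diff_divide_distrib)
  qed
  moreover have "(\<lambda>n. Q (y n) / \<mu>\<^sup>2) \<longlonglongrightarrow> 0"
    using Qy by (rule tendsto_divide_zero)
  ultimately have "(\<lambda>n. ?p (xs n - x)) \<longlonglongrightarrow> 0"
    using LUR_x unfolding LUR_point_def by simp
  moreover have "c * (1/2) / \<mu> \<le> ?p (xs n - x)" for n
  proof -
    have "xs n - x = (1 / \<mu>) *\<^sub>R y n"
      by (simp add: x_def xs_def scaleR_right_distrib)
    moreover have "c * (1/2) \<le> ?p (y n)"
      using c(2)[of "y n"] le_rotund[of q "y n"] y(2)[of n] by simp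
    then have "c * (1/2) / \<mu> \<le> ?p (y n) / \<mu>"
      using \<mu> by (intro divide_right_mono) auto
    ultimately show ?thesis by (simp only: scale)
  qed
  ultimately have "c * (1/2) / \<mu> \<le> 0"
    by (intro LIMSEQ_le_const) auto
  then show False using c(1) \<mu> by (simp add: divide_le_0_iff)
qed

theorem mainTheorem3:
  assumes "separable_space (euclidean :: 'a::banach topology)"
    and "infinite_dimensional (UNIV :: 'a set)"
  shows "\<exists>p :: 'a \<Rightarrow> real. equivalent_norm p \<and> gateaux_smooth p \<and> URED p \<and> \<not> LUR p"
proof -
  obtain b :: "nat \<Rightarrow> 'a" where b: "\<And>y e. e > 0 \<Longrightarrow> \<exists>i. norm (y - b i) < e"
    using separable_dense_sequence[OF assms(1)] by blast
  obtain f :: "nat \<Rightarrow> 'a \<Rightarrow> real" where f: "\<And>i. linear (f i)" "\<And>i y. \<bar>f i y\<bar> \<le> norm y"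
    "\<And>z. z \<noteq> 0 \<Longrightarrow> \<exists>i. f i z \<noteq> 0"
    using ex_separating_functionals[OF b] by blast
  interpret functional_sequence f
    by (rule functional_sequence.intro) (fact f)+
  obtain z :: 'a where "z \<noteq> 0"
    using infinite_dimensional_ex_common_kernel[OF assms(2) f(1)] by blast
  \<comment> \<open>One member of the separating sequence also serves as the functional whose level
    hyperplane carries the flat piece; scaling \<open>z\<close> puts \<open>x0\<close> on
    it.\<close>
  then obtain i where i: "f i z \<noteq> 0" using f(3) by blast
  define x0 where "x0 = (1 / f i z) *\<^sub>R z"
  have x0: "f i x0 = 1" using i by (simp add: x0_def linear_cmul[OF f(1)])
  obtain q where q: "equivalent_norm q" "sq_smooth q"
    "\<And>y. f i y = 0 \<Longrightarrow> norm y \<le> 1/2 \<Longrightarrow> q (x0 + y) = sqrt (1/2)"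
    using ex_sq_smooth_flat_norm[OF b f(1) f(2) x0] by blast
  obtain c C where cC: "c > 0" "C > 0" "\<And>x. c * norm x \<le> q x" "\<And>x. q x \<le> C * norm x"
    using q(1) unfolding equivalent_norm_def by blast
  have q_norm: "is_norm q" using q(1) by (simp add: equivalent_norm_def)
  have p_norm: "is_norm (rotund q)" by (rule is_norm_rotund[OF q_norm])
  have "c * norm x \<le> rotund q x \<and> rotund q x \<le> (C + 2) * norm x" for x
    using cC(3)[of x] le_rotund[of q x] rotund_le[OF q_norm cC(4)] by auto
  then have "equivalent_norm (rotund q)"
    unfolding equivalent_norm_def using p_norm cC(1,2) by (metis add_pos_pos zero_less_numeral)
  moreover have "gateaux_smooth (rotund q)"
    by (intro sq_smooth_imp_gateaux_smooth p_norm sq_smooth_rotund q(2))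
  moreover have "URED (rotund q)"
    using q_norm f(3) by (rule URED_rotund)
  moreover have "\<not> LUR (rotund q)"
    using not_LUR_rotund[OF assms(2) q(1) f(1) x0 q(3)] .
  ultimately show ?thesis by blast
qed

end
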